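(* Let $-1 < v_{\min} < 0 < v_{\max} < \infty$, $X_0>0$ and $\alpha \ge 0$. Define $$\alpha_s \doteq \frac{1}{4|v_{\min}|(1+v_{\min})}, \qquad \alpha^* \doteq \frac{v_{\max}-v_{\min}}{|v_{\min}|(1+v_{\max})^2},$$ and $$\alpha_+ \doteq \begin{cases} \alpha^* & \text{if } v_{\max} > 1+2v_{\min},\\ \alpha_s & \text{if } v_{\max} \le 1+2v_{\min}.\end{cases}$$ Then the condition $\alpha \le \alpha_+$ is necessary for all-time positivity. Equivalently, if $\alpha > \alpha_+$, then there exists an admissible path $v \in \mathcal{V}$ such that $X(v,k) \le 0$ for some $k$.
   Context: An admissible path is a sequence $v=\{v(k)\}_{k=0}^\infty$ of real numbers with $v_{\min} \le v(k) \le v_{\max}$ for all $k \ge 0$; $\mathcal{V}$ denotes the set of all admissible paths. For a feedback gain $\alpha \ge 0$ and $v \in \mathcal{V}$, the state $X(v,k)$ is defined by $X(v,0)=X(v,1)=X_0>0$ and, for $k \ge 1$, $$X(v,k+1) = X(v,k) + \alpha\,(1+v(k-1))\,v(k)\,X(v,k-1).$$ For a given $\alpha\ge 0$, the all-time positivity condition is said to hold if $X(v,k)>0$ for all $v\in\mathcal{V}$ and all $k \ge 0$. *)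

theory Defs
  imports Complex_Main
begin

definition admissible_paths :: "real \<Rightarrow> real \<Rightarrow> (nat \<Rightarrow> real) set" where
  "admissible_paths vmin vmax = {v. \<forall>k. vmin \<le> v k \<and> v k \<le> vmax}"

fun state :: "real \<Rightarrow> real \<Rightarrow> (nat \<Rightarrow> real) \<Rightarrow> nat \<Rightarrow> real" where
  "state \<alpha> X0 v 0 = X0"
| "state \<alpha> X0 v (Suc 0) = X0"
| "state \<alpha> X0 v (Suc (Suc k)) =
     state \<alpha> X0 v (Suc k) + \<alpha> * (1 + v k) * v (Suc k) * state \<alpha> X0 v k"

definition all_time_positivity :: "real \<Rightarrow> real \<Rightarrow> real \<Rightarrow> real \<Rightarrow> bool" where
  "all_time_positivity vmin vmax X0 \<alpha> \<longleftrightarrow>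
     (\<forall>v \<in> admissible_paths vmin vmax. \<forall>k. state \<alpha> X0 v k > 0)"

definition alpha_s :: "real \<Rightarrow> real" where
  "alpha_s vmin = 1 / (4 * \<bar>vmin\<bar> * (1 + vmin))"

definition alpha_star :: "real \<Rightarrow> real \<Rightarrow> real" where
  "alpha_star vmin vmax = (vmax - vmin) / (\<bar>vmin\<bar> * (1 + vmax)\<^sup>2)"

definition alpha_plus :: "real \<Rightarrow> real \<Rightarrow> real" where
  "alpha_plus vmin vmax =
     (if vmax > 1 + 2 * vmin then alpha_star vmin vmax else alpha_s vmin)"

end

theory Submission
  imports Defs
begin

text \<open>
  Along a path that is eventually constant equal to \<open>vmin\<close>, the state satisfies the linear recurrence
  \<open>y (n + 2) = y (n + 1) - c * y n\<close> with \<open>c = \<alpha> * \<bar>vmin\<bar> * (1 + vmin)\<close>, so that its successive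
  ratios obey \<open>r' = 1 - c / r = r - (r\<^sup>2 - r + c) / r\<close>. They stay positive for ever only if they are
  not driven below the fixed points of this map, that is, the roots of \<open>r\<^sup>2 - r + c\<close>. If this
  quadratic is bounded below by a positive constant on all ratios up to the initial one, every step
  lowers the ratio by at least that constant, and positivity is lost after finitely many steps
  (\<open>linear_recurrence_loses_positivity\<close>).

  There are two ways for the adversary to get into this situation. If \<open>\<alpha> > alpha_s\<close>, then \<open>c > 1/4\<close>
  and the quadratic has no real root: the constant path \<open>vmin\<close> does it. If
  \<open>vmax > 1 + 2 * vmin\<close>, a smaller gain suffices when one plays \<open>vmax\<close> once and \<open>vmin\<close> ever after:
  the first step gives the ratio
  \<open>\<rho> = 1 - \<alpha> * \<bar>vmin\<bar> * (1 + vmax)\<close>, at which the quadratic equals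
  \<open>\<alpha> * \<bar>vmin\<bar> * (\<alpha> * \<bar>vmin\<bar> * (1 + vmax)\<^sup>2 - (vmax - vmin))\<close>. This is positive exactly when
  \<open>\<alpha> > alpha_star\<close>, and the condition \<open>vmax > 1 + 2 * vmin\<close> makes \<open>\<rho> < 1/2\<close>, which places \<open>\<rho>\<close> below the
  smaller root rather than above the larger one.
\<close>

text \<open>
  Under the assumption that all terms are positive, the ratio \<open>y (n + 1) / y n\<close> would be at most
  \<open>\<rho> - n * \<delta>\<close>: each step subtracts \<open>(r\<^sup>2 - r + c) / r\<close> from the ratio \<open>r\<close>, and this is at least
  \<open>\<delta>\<close> because \<open>r \<le> \<rho> \<le> 1\<close>.
\<close>
lemma linear_recurrence_loses_positivity:
  fixes y :: "nat \<Rightarrow> real" and c \<rho> \<delta> :: real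
  assumes rec: "\<And>n. y (Suc (Suc n)) = y (Suc n) - c * y n"
    and start: "y (Suc 0) \<le> \<rho> * y 0"
    and "\<rho> \<le> 1" and "\<delta> > 0"
    and gap: "\<And>r. 0 < r \<Longrightarrow> r \<le> \<rho> \<Longrightarrow> \<delta> \<le> r\<^sup>2 - r + c"
  shows "\<exists>n. y n \<le> 0"
proof (rule ccontr)
  assume "\<not> ?thesis"
  then have pos: "y n > 0" for n
    by (meson not_le)
  have ratio: "y (Suc n) / y n \<le> \<rho> - real n * \<delta>" for n
  proof (induction n)
    case 0
    then show ?case
      using start pos[of 0] by (simp add: divide_le_eq)
  next
    case (Suc n)
    define r where "r = y (Suc n) / y n"
    have r_pos: "r > 0"
      using pos by (simp add: r_def)
    have r_le: "r \<le> \<rho> - real n * \<delta>"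
      using Suc.IH by (simp add: r_def)
    have "real n * \<delta> \<ge> 0"
      using \<open>\<delta> > 0\<close> by simp
    then have "r \<le> \<rho>"
      using r_le by linarith
    have "\<delta> * r \<le> \<delta>"
      using \<open>r \<le> \<rho>\<close> \<open>\<rho> \<le> 1\<close> \<open>\<delta> > 0\<close> by (simp add: mult_le_cancel_left1)
    also have "\<dots> \<le> r\<^sup>2 - r + c"
      by (rule gap[OF r_pos \<open>r \<le> \<rho>\<close>])
    finally have "1 - c / r \<le> r - \<delta>"
      using r_pos by (simp add: field_simps power2_eq_square)
    moreover have "y (Suc (Suc n)) / y (Suc n) = 1 - c / r"
      using pos[of n] pos[of "Suc n"] by (simp add: rec r_def diff_divide_distrib)
    ultimately have "y (Suc (Suc n)) / y (Suc n) \<le> r - \<delta>"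
      by simp
    then show ?case
      using r_le by (simp add: algebra_simps)
  qed
  obtain n where "\<rho> < real n * \<delta>"
    using reals_Archimedean3[OF \<open>\<delta> > 0\<close>] by blast
  then have "y (Suc n) / y n < 0"
    using ratio[of n] by linarith
  moreover have "y (Suc n) / y n > 0"
    using pos by simp
  ultimately show False
    by linarith
qed

lemma constant_path_loses_positivity:
  fixes vmin X0 \<alpha> :: real
  assumes "-1 < vmin" and "vmin < 0" and "\<alpha> > alpha_s vmin"
  shows "\<exists>k. state \<alpha> X0 (\<lambda>_. vmin) k \<le> 0"
proof -
  define c where "c = \<alpha> * (- vmin) * (1 + vmin)"
  have "4 * (- vmin) * (1 + vmin) > 0"
    using assms by (simp add: mult_neg_pos)
  then have "c > 1 / 4"
    using assms(2,3) by (simp add: alpha_s_def c_def field_simps)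
  show ?thesis
  proof (rule linear_recurrence_loses_positivity[where c = c and \<rho> = 1 and \<delta> = "c - 1 / 4"])
    fix r :: real
    have "(r - 1 / 2)\<^sup>2 \<ge> 0"
      by simp
    then show "c - 1 / 4 \<le> r\<^sup>2 - r + c"
      by (simp add: power2_eq_square algebra_simps)
  qed (use \<open>c > 1 / 4\<close> in \<open>simp_all add: c_def algebra_simps\<close>)
qed

lemma peak_path_loses_positivity:
  fixes vmin vmax X0 \<alpha> :: real
  assumes "vmin < 0" and "0 < vmax" and peak: "vmax > 1 + 2 * vmin"
    and "\<alpha> \<ge> 0" and "\<alpha> > alpha_star vmin vmax"
  shows "\<exists>k. state \<alpha> X0 (\<lambda>k. if k = 0 then vmax else vmin) k \<le> 0"
proof -
  let ?v = "\<lambda>k::nat. if k = 0 then vmax else vmin"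
  define a where "a = \<alpha> * (- vmin)"
  define c where "c = a * (1 + vmin)"
  define \<rho> where "\<rho> = 1 - a * (1 + vmax)"
  define \<delta> where "\<delta> = \<rho>\<^sup>2 - \<rho> + c"
  have "- vmin * (1 + vmax)\<^sup>2 > 0"
    using assms by (simp add: mult_neg_pos)
  moreover have "(vmax - vmin) / (- vmin * (1 + vmax)\<^sup>2) < \<alpha>"
    using assms(1,5) by (simp add: alpha_star_def)
  ultimately have "vmax - vmin < \<alpha> * (- vmin * (1 + vmax)\<^sup>2)"
    using pos_divide_less_eq by blast
  then have a_gt: "a * (1 + vmax)\<^sup>2 > vmax - vmin"
    by (simp add: a_def ac_simps)
  have "a \<ge> 0"
    using assms by (simp add: a_def mult_nonneg_nonpos)
  moreover have "a \<noteq> 0"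
    using a_gt assms by auto
  ultimately have "a > 0"
    by simp
  have "\<delta> = a * (a * (1 + vmax)\<^sup>2 - (vmax - vmin))"
    by (simp add: \<delta>_def \<rho>_def c_def power2_eq_square algebra_simps)
  then have "\<delta> > 0"
    using \<open>a > 0\<close> a_gt by simp
  have "(1 + vmax) * (2 * (a * (1 + vmax))) > (1 + vmax) * 1"
    using a_gt peak by (simp add: power2_eq_square algebra_simps)
  then have "2 * (a * (1 + vmax)) > 1"
    using \<open>0 < vmax\<close> by (subst (asm) mult_less_cancel_left_pos) auto
  then have "\<rho> < 1 / 2"
    by (simp add: \<rho>_def)
  \<comment> \<open>The recurrence has constant coefficients only from index 1 on, once the peak has been used up.\<close>
  have "\<exists>n. state \<alpha> X0 ?v (Suc n) \<le> 0"
  proof (rule linear_recurrence_loses_positivity[where c = c and \<rho> = \<rho> and \<delta> = \<delta>])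
    fix r :: real
    assume "0 < r" "r \<le> \<rho>"
    then have "(\<rho> - r) * (1 - \<rho> - r) \<ge> 0"
      using \<open>\<rho> < 1 / 2\<close> by simp
    then show "\<delta> \<le> r\<^sup>2 - r + c"
      by (simp add: \<delta>_def power2_eq_square algebra_simps)
  next
    show "\<rho> \<le> 1" "\<delta> > 0"
      using \<open>\<rho> < 1 / 2\<close> \<open>\<delta> > 0\<close> by simp_all
  qed (simp_all add: \<rho>_def c_def a_def algebra_simps)
  then show ?thesis
    by blast
qed

theorem mainTheorem2:
  fixes vmin vmax X0 \<alpha> :: real
  assumes "-1 < vmin" and "vmin < 0" and "0 < vmax" and "X0 > 0" and "\<alpha> \<ge> 0"
  shows "(all_time_positivity vmin vmax X0 \<alpha> \<longrightarrow> \<alpha> \<le> alpha_plus vmin vmax) \<and>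
    (\<alpha> > alpha_plus vmin vmax \<longrightarrow>
      (\<exists>v \<in> admissible_paths vmin vmax. \<exists>k. state \<alpha> X0 v k \<le> 0))"
proof -
  have bad_path: "\<exists>v \<in> admissible_paths vmin vmax. \<exists>k. state \<alpha> X0 v k \<le> 0"
    if gt: "\<alpha> > alpha_plus vmin vmax"
  proof (cases "vmax > 1 + 2 * vmin")
    case True
    then have "\<alpha> > alpha_star vmin vmax"
      using gt by (simp add: alpha_plus_def)
    then have "\<exists>k. state \<alpha> X0 (\<lambda>k. if k = 0 then vmax else vmin) k \<le> 0"
      using assms True by (intro peak_path_loses_positivity)
    moreover have "(\<lambda>k. if k = 0 then vmax else vmin) \<in> admissible_paths vmin vmax"
      using assms by (simp add: admissible_paths_def)
    ultimately show ?thesis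
      by blast
  next
    case False
    then have "\<alpha> > alpha_s vmin"
      using gt by (simp add: alpha_plus_def)
    then have "\<exists>k. state \<alpha> X0 (\<lambda>_. vmin) k \<le> 0"
      using assms by (intro constant_path_loses_positivity)
    moreover have "(\<lambda>_. vmin) \<in> admissible_paths vmin vmax"
      using assms by (simp add: admissible_paths_def)
    ultimately show ?thesis
      by blast
  qed
  moreover have "\<alpha> \<le> alpha_plus vmin vmax" if "all_time_positivity vmin vmax X0 \<alpha>"
    using bad_path that unfolding all_time_positivity_def by (meson not_le)
  ultimately show ?thesis
    by blast
qed

end
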